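(* Let $n,m>1$ be coprime integers and let $\xi_m$ be a primitive $m$-th root of unity. For every Dirichlet character $\chi$ modulo $m$ put $$C_\chi(\xi_m)=\sum_{g\in G(m)}\overline{\chi}(g)\log(1-\xi_m^g),$$ where the logarithm is taken with imaginary part in $(-\pi,\pi]$. Then $$\Phi_n(\xi_m)=\exp\left(\frac{1}{\varphi(m)}\sum_{\chi\in\widehat{G}(m)}C_\chi(\xi_m)\,\chi(n)\prod_{p\mid n}\bigl(1-\overline{\chi}(p)\bigr)\right),$$ where the product runs over the primes $p$ dividing $n$.
   Context: $\Phi_n(x)=\prod_{1\le j\le n,\ \gcd(j,n)=1}(x-e^{2\pi i j/n})$ denotes the $n$-th cyclotomic polynomial, and $\varphi$ is Euler's totient function. $G(m)=(\mathbb Z/m\mathbb Z)^*$ is the multiplicative group modulo $m$, and $\widehat{G}(m)=\mathrm{Hom}((\mathbb Z/m\mathbb Z)^*,\mathbb C^* )$ is the set of Dirichlet characters modulo $m$ (extended to integers as usual, with $\chi(a)=0$ when $\gcd(a,m)>1$). A primitive $m$-th root of unity is a complex $z$ with $z^m=1$ but $z^d\ne1$ for $1\le d<m$. *)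

theory Defs
  imports "HOL-Analysis.Analysis" "HOL-Number_Theory.Number_Theory"
begin

definition cyclotomic_poly :: "nat \<Rightarrow> complex poly" where
  "cyclotomic_poly n =
     (\<Prod>j | 1 \<le> j \<and> j \<le> n \<and> coprime j n.
        [:- exp (2 * of_real pi * \<i> * of_nat j / of_nat n), 1:])"

definition primitive_root_of_unity :: "nat \<Rightarrow> complex \<Rightarrow> bool" where
  "primitive_root_of_unity m z \<longleftrightarrow> z ^ m = 1 \<and> (\<forall>d. 1 \<le> d \<and> d < m \<longrightarrow> z ^ d \<noteq> 1)"

text \<open>
  The elements of \<open>mult_group_mod m\<close> are the residues in \<open>{0..m - 1}\<close> that are units modulo \<open>m\<close>
  (for \<open>m > 1\<close>).
\<close>

definition mult_group_mod :: "nat \<Rightarrow> int monoid" where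
  "mult_group_mod m = units_of (residue_ring (int m))"

definition complex_mult_group :: "complex monoid" where
  "complex_mult_group = \<lparr>carrier = - {0}, monoid.mult = (*), one = 1\<rparr>"

text \<open>
  The set \<open>hom G H\<close> does not constrain the values of its members outside \<open>carrier G\<close>. The
  extension to all integers overwrites these values, so each homomorphism on the group gives
  exactly one element of \<open>dirichlet_characters m\<close>.
\<close>

definition extend_character :: "nat \<Rightarrow> (int \<Rightarrow> complex) \<Rightarrow> int \<Rightarrow> complex" where
  "extend_character m h a = (if coprime a (int m) then h (a mod int m) else 0)"

definition dirichlet_characters :: "nat \<Rightarrow> (int \<Rightarrow> complex) set" where
  "dirichlet_characters m = extend_character m ` hom (mult_group_mod m) complex_mult_group"

text \<open>
  \<open>Ln\<close> is the branch of the logarithm with imaginary part in \<open>(-\<pi>, \<pi>]\<close>.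
\<close>

definition C_chi :: "nat \<Rightarrow> (int \<Rightarrow> complex) \<Rightarrow> complex \<Rightarrow> complex" where
  "C_chi m chi \<xi> = (\<Sum>g\<in>carrier (mult_group_mod m). cnj (chi g) * Ln (1 - \<xi> powi g))"

end

theory Submission
  imports Defs "HOL-Computational_Algebra.Fundamental_Theorem_Algebra"
begin

text \<open>
  Inclusion-exclusion over the sets \<open>S\<close> of prime divisors of \<open>n\<close> gives, for \<open>x ^ n \<noteq> 1\<close>, that
  \<open>\<Phi>\<^sub>n(x)\<close> is the product of the factors \<open>(1 - x ^ (n / \<Prod>S)) powi (-1) ^ |S|\<close>; the signs turning
  \<open>x ^ k - 1\<close> into \<open>1 - x ^ k\<close> cancel because the number of sets \<open>S\<close> is even. On the other side,
  \<open>\<eta>(n) \<Prod>\<^sub>p (1 - cnj (\<eta> p))\<close> expands into the sum of \<open>(-1) ^ |S| \<eta>(n / \<Prod>S)\<close>, and orthogonality of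
  characters extracts from \<open>C_chi\<close> exactly the logarithm of \<open>1 - \<xi> ^ (n / \<Prod>S)\<close>. Orthogonality needs
  a character separating a given element from \<open>1\<close>, which is obtained by extending characters from
  a subgroup to the whole group, one generator at a time.
\<close>

section \<open>Characters of finite abelian groups\<close>

lemma complex_mult_group_simps [simp]:
  "carrier complex_mult_group = - {0}"
  "monoid.mult complex_mult_group = (*)"
  by (simp_all add: complex_mult_group_def)

text \<open>The new subgroup consists of the products \<open>h \<otimes> x [^] i\<close>, on which
  the extension takes the value \<open>\<eta> h * w powi i\<close>. Two such representations of one
  element differ by a power of \<open>x\<close> lying in \<open>H\<close>. By minimality of
  \<open>k\<close> this is a power of \<open>x [^] k\<close>, where the condition on
  \<open>w\<close> makes the two values agree. Prescribing \<open>w\<close> lets the caller control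
  the value at \<open>x\<close>.\<close>

lemma (in comm_group) extend_hom_adjoin:
  fixes x :: 'a and k :: nat and w :: complex
  assumes H: "subgroup H G" and chi: "\<eta> \<in> hom (G\<lparr>carrier := H\<rparr>) complex_mult_group"
    and x: "x \<in> carrier G" and k: "k > 0" "x [^] k \<in> H"
    and min: "\<And>j. \<lbrakk>0 < j; j < k\<rbrakk> \<Longrightarrow> x [^] j \<notin> H" and w: "w ^ k = \<eta> (x [^] k)"
  obtains H' \<eta>' where "subgroup H' G" "H \<subseteq> H'" "x \<in> H'"
    "\<eta>' \<in> hom (G\<lparr>carrier := H'\<rparr>) complex_mult_group" "\<And>h. h \<in> H \<Longrightarrow> \<eta>' h = \<eta> h" "\<eta>' x = w"
proof -
  interpret H: subgroup H G by (rule H)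
  have nz: "\<eta> h \<noteq> 0" if "h \<in> H" for h
    using chi that by (auto simp: hom_def)
  have mult: "\<eta> (h \<otimes> h') = \<eta> h * \<eta> h'" if "h \<in> H" "h' \<in> H" for h h'
    using chi that by (auto simp: hom_def)
  have one: "\<eta> \<one> = 1"
    using mult[of \<one> \<one>] nz[of \<one>] by simp
  have [simp]: "w \<noteq> 0"
    using w nz[OF k(2)] k(1) by (auto simp: power_0_left)
  have inH: "h \<in> carrier G" if "h \<in> H" for h using that by simp
  have inv: "\<eta> (inv h) = inverse (\<eta> h)" if "h \<in> H" for h
  proof -
    have "\<eta> (inv h) * \<eta> h = 1"
      using mult[of "inv h" h] that one by simp
    thus ?thesis using nz[OF that] by (simp add: field_simps)
  qed
  have npow: "\<eta> (y [^] n) = \<eta> y ^ n \<and> y [^] n \<in> H" if "y \<in> H" for y and n :: nat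
    using that by (induction n) (auto simp: one mult)
  have ipow: "\<eta> (y [^] i) = \<eta> y powi i \<and> y [^] i \<in> H" if "y \<in> H" for y and i :: int
  proof (cases i rule: int_cases2)
    case (nonneg n)
    thus ?thesis using npow[OF that, of n] by (simp add: int_pow_int)
  next
    case (nonpos n)
    thus ?thesis
      using npow[OF that, of n] that by (simp add: int_pow_neg_int inv power_int_minus)
  qed
  have xpow: "x [^] i = (x [^] k) [^] (i div int k) \<otimes> x [^] (i mod int k)" for i :: int
  proof -
    have "(x [^] k) [^] (i div int k) \<otimes> x [^] (i mod int k)
        = x [^] (int k * (i div int k) + i mod int k)"
      using x by (simp only: int_pow_int[symmetric] int_pow_pow int_pow_mult)
    thus ?thesis by simp
  qed
  \<comment> \<open>Dividing \<open>i\<close> by \<open>k\<close> with remainder puts the remainder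
    power of \<open>x\<close> into \<open>H\<close>, so minimality forces the remainder to be
    0.\<close>
  have xval: "\<eta> (x [^] i) = w powi i" if i: "x [^] i \<in> H" for i :: int
  proof -
    let ?r = "nat (i mod int k)"
    have xr: "x [^] (i mod int k) = x [^] ?r"
      using k by (simp add: int_pow_def2 not_less)
    have "x [^] ?r = inv ((x [^] k) [^] (i div int k)) \<otimes> x [^] i"
      using xpow[of i] x xr by (simp add: inv_solve_left)
    hence "x [^] ?r \<in> H"
      using ipow[OF k(2)] i by simp
    moreover have "?r < k"
      using k by (simp add: nat_less_iff)
    ultimately have "?r = 0"
      using min by blast
    hence i': "i mod int k = 0"
      using k by (metis int_nat_eq of_nat_0 pos_mod_sign of_nat_0_less_iff not_less)
    have "\<eta> (x [^] i) = (w ^ k) powi (i div int k)"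
      using xpow[of i] i' ipow[OF k(2)] w x by simp
    also have "\<dots> = w powi (int k * (i div int k))"
      by (simp add: power_int_mult)
    also have "int k * (i div int k) = i"
      using i' by auto
    finally show ?thesis .
  qed
  define H' where "H' = {h \<otimes> x [^] (i::int) | h i. h \<in> H}"
  have H'I: "h \<otimes> x [^] i \<in> H'" if "h \<in> H" for h and i :: int
    using that by (auto simp: H'_def)
  have H'E: "\<exists>h\<in>H. \<exists>i::int. y = h \<otimes> x [^] i" if "y \<in> H'" for y
    using that by (auto simp: H'_def)
  have HH': "h \<in> H'" if "h \<in> H" for h
    using H'I[OF that, of 0] that by simp
  have prod: "(h \<otimes> x [^] i) \<otimes> (h' \<otimes> x [^] j) = (h \<otimes> h') \<otimes> x [^] (i + j)"
    if "h \<in> H" "h' \<in> H" for h h' and i j :: int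
    using that x by (simp add: int_pow_mult m_ac)
  have inverse: "inv (h \<otimes> x [^] i) = inv h \<otimes> x [^] (-i)" if "h \<in> H" for h and i :: int
    using that x by (simp add: inv_mult int_pow_neg)
  have sub: "subgroup H' G"
  proof
    show "H' \<subseteq> carrier G" using x by (auto simp: H'_def)
    show "\<one> \<in> H'" using HH' by simp
    show "y \<otimes> z \<in> H'" if yz: "y \<in> H'" "z \<in> H'" for y z
      using H'E[OF yz(1)] H'E[OF yz(2)] prod H'I by (metis H.m_closed)
    show "inv y \<in> H'" if "y \<in> H'" for y
      using H'E[OF that] inverse H'I by (metis H.m_inv_closed)
  qed
  \<comment> \<open>Independence of the representation: \<open>inv h' \<otimes> h\<close> is a power
    of \<open>x\<close> inside \<open>H\<close>, so \<open>xval\<close> gives its value.\<close>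
  have wd: "\<eta> h * w powi i = \<eta> h' * w powi j"
    if h: "h \<in> H" "h' \<in> H" and eq: "h \<otimes> x [^] i = h' \<otimes> x [^] j" for h h' and i j :: int
  proof -
    have cl: "h \<in> carrier G" "h' \<in> carrier G" "x [^] i \<in> carrier G" "x [^] j \<in> carrier G"
      using h x by auto
    have "h = h' \<otimes> x [^] j \<otimes> inv (x [^] i)"
      using cl eq by (subst inv_solve_right) auto
    also have "\<dots> = h' \<otimes> x [^] (j - i)"
      using cl x by (simp add: int_pow_diff m_assoc)
    finally have *: "inv h' \<otimes> h = x [^] (j - i)"
      using cl x by (metis inv_solve_left int_pow_closed)
    hence "\<eta> (inv h' \<otimes> h) = w powi (j - i)"
      using xval[of "j - i"] h by (metis H.m_closed H.m_inv_closed)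
    hence "\<eta> h / \<eta> h' = w powi j / w powi i"
      using h by (simp add: mult inv power_int_diff field_simps)
    thus ?thesis using nz[OF h(2)] by (simp add: field_simps)
  qed
  \<comment> \<open>The choice is harmless: by \<open>wd\<close> only one value \<open>v\<close>
    qualifies for each element of \<open>H'\<close>.\<close>
  define \<eta>' where "\<eta>' = (\<lambda>y. SOME v. \<exists>h\<in>H. \<exists>i::int. y = h \<otimes> x [^] i \<and> v = \<eta> h * w powi i)"
  have val: "\<eta>' (h \<otimes> x [^] i) = \<eta> h * w powi i" if h: "h \<in> H" for h and i :: int
    unfolding \<eta>'_def
  proof (rule some_equality)
    show "\<exists>ha\<in>H. \<exists>ia. h \<otimes> x [^] i = ha \<otimes> x [^] ia \<and> \<eta> h * w powi i = \<eta> ha * w powi ia"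
      using h by blast
  next
    fix v assume "\<exists>ha\<in>H. \<exists>ia. h \<otimes> x [^] i = ha \<otimes> x [^] ia \<and> v = \<eta> ha * w powi ia"
    thus "v = \<eta> h * w powi i" using wd h by metis
  qed
  show thesis
  proof (rule that[OF sub])
    show "H \<subseteq> H'" using HH' by blast
    show "x \<in> H'" using H'I[of \<one> 1] x by simp
    show "\<eta>' h = \<eta> h" if "h \<in> H" for h
      using val[OF that, of 0] that by simp
    show "\<eta>' x = w" using val[of \<one> 1] x one by simp
    show "\<eta>' \<in> hom (G\<lparr>carrier := H'\<rparr>) complex_mult_group"
    proof (rule homI)
      fix y assume "y \<in> carrier (G\<lparr>carrier := H'\<rparr>)"
      then obtain h i where "h \<in> H" "y = h \<otimes> x [^] (i::int)" using H'E[of y] by auto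
      thus "\<eta>' y \<in> carrier complex_mult_group" by (simp add: val nz)
    next
      fix y z assume "y \<in> carrier (G\<lparr>carrier := H'\<rparr>)" "z \<in> carrier (G\<lparr>carrier := H'\<rparr>)"
      hence "y \<in> H'" "z \<in> H'" by simp_all
      from this[THEN H'E] obtain h i h' j where
        "h \<in> H" "y = h \<otimes> x [^] (i::int)" "h' \<in> H" "z = h' \<otimes> x [^] (j::int)"
        by blast
      thus "\<eta>' (y \<otimes>\<^bsub>G\<lparr>carrier := H'\<rparr>\<^esub> z) = \<eta>' y \<otimes>\<^bsub>complex_mult_group\<^esub> \<eta>' z"
        by (simp add: prod val mult power_int_add)
    qed
  qed
qed

text \<open>Induction on the number of elements outside \<open>H\<close>: while some
  \<open>x\<close> is missing, adjoin it, with any \<open>k\<close>-th root of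
  \<open>\<eta> (x [^] k)\<close> as its value.\<close>

lemma (in comm_group) extend_hom:
  assumes fin: "finite (carrier G)" and H: "subgroup H G"
    and chi: "\<eta> \<in> hom (G\<lparr>carrier := H\<rparr>) complex_mult_group"
  shows "\<exists>\<psi>\<in>hom G complex_mult_group. \<forall>h\<in>H. \<psi> h = \<eta> h"
  using H chi
proof (induction "card (carrier G - H)" arbitrary: H \<eta> rule: less_induct)
  case less
  interpret H: subgroup H G by (rule less.prems)
  show ?case
  proof (cases "H = carrier G")
    case True
    thus ?thesis using less.prems(2) by (intro bexI[of _ \<eta>]) auto
  next
    case False
    then obtain x where x: "x \<in> carrier G" "x \<notin> H" using H.subset by blast
    define k where "k = (LEAST j::nat. 0 < j \<and> x [^] j \<in> H)"
    \<comment> \<open>By Lagrange the group order is an admissible exponent, so the least one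
      exists.\<close>
    have ex: "0 < order G \<and> x [^] order G \<in> H"
      using x fin by (simp add: pow_order_eq_1 order_gt_0_iff_finite)
    have k: "0 < k \<and> x [^] k \<in> H"
      unfolding k_def by (rule LeastI[of "\<lambda>j. 0 < j \<and> x [^] j \<in> H", OF ex])
    have min: "x [^] j \<notin> H" if "0 < j" "j < k" for j :: nat
      using not_less_Least[of j "\<lambda>j. 0 < j \<and> x [^] j \<in> H"] that by (auto simp: k_def)
    have "\<eta> (x [^] k) \<noteq> 0" using less.prems(2) k by (auto simp: hom_def)
    then obtain w where w: "w ^ k = \<eta> (x [^] k)"
      using bij_betw_nth_root_unity[of "\<eta> (x [^] k)" k] k
      by (metis (mono_tags, lifting) bij_betw_apply mem_Collect_eq power_one)
    obtain H' \<eta>' where *: "subgroup H' G" "H \<subseteq> H'" "x \<in> H'"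
      "\<eta>' \<in> hom (G\<lparr>carrier := H'\<rparr>) complex_mult_group" "\<And>h. h \<in> H \<Longrightarrow> \<eta>' h = \<eta> h"
      using extend_hom_adjoin[OF less.prems x(1) _ _ min w] k by metis
    have "card (carrier G - H') < card (carrier G - H)"
      using * x fin by (intro psubset_card_mono) auto
    from less.hyps[OF this *(1,4)] show ?thesis using *(2,5) by (metis subsetD)
  qed
qed

text \<open>Adjoin \<open>a\<close> to the trivial subgroup, where the least exponent is the order
  of \<open>a\<close>. A root of unity other than 1 may then be prescribed as the value at
  \<open>a\<close>, and the result extends to the whole group.\<close>

lemma (in comm_group) hom_separates:
  assumes fin: "finite (carrier G)" and a: "a \<in> carrier G" "a \<noteq> \<one>"
  obtains \<psi> where "\<psi> \<in> hom G complex_mult_group" "\<psi> a \<noteq> 1"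
proof -
  let ?k = "ord a"
  have k: "?k > 1"
    using ord_ge_1[OF fin a(1)] ord_eq_1[OF a(1)] a(2) by linarith
  define w where "w = cis (2 * pi / real ?k)"
  have "w \<noteq> 1"
  proof
    assume "w = 1"
    \<comment> \<open>The enumeration of the roots of unity is injective, so the indices 1 and 0
      give different roots.\<close>
    have "inj_on (\<lambda>j. cis (2 * pi * real j / real ?k)) {..<?k}"
      using Complex.bij_betw_roots_unity[of ?k] k by (simp add: bij_betw_def)
    from inj_onD[OF this, of 1 0] show False
      using \<open>w = 1\<close> k by (simp add: w_def)
  qed
  have w: "w ^ ?k = (\<lambda>_. 1) (a [^] ?k)"
    using k by (simp add: w_def Complex.DeMoivre)
  have min: "a [^] j \<notin> {\<one>}" if "0 < j" "j < ?k" for j :: nat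
    using that a by (auto simp: pow_eq_id dest: dvd_imp_le)
  have tr: "(\<lambda>_. 1) \<in> hom (G\<lparr>carrier := {\<one>}\<rparr>) complex_mult_group"
    by (auto simp: hom_def)
  obtain H' \<eta>' where *: "subgroup H' G" "a \<in> H'"
    "\<eta>' \<in> hom (G\<lparr>carrier := H'\<rparr>) complex_mult_group" "\<eta>' a = w"
    using extend_hom_adjoin[OF triv_subgroup tr a(1) _ _ min w] k a by (metis insertI1 less_trans pow_ord_eq_1 zero_less_one)
  show thesis
    using extend_hom[OF fin *(1,3)] * \<open>w \<noteq> 1\<close> that by metis
qed

text \<open>Members of \<open>hom\<close> are unconstrained outside the carrier; extensionality
  leaves one function per homomorphism, so that the characters can be counted and summed
  over.\<close>

definition characters :: "('a, 'b) monoid_scheme \<Rightarrow> ('a \<Rightarrow> complex) set" where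
  "characters G = hom G complex_mult_group \<inter> extensional (carrier G)"

section \<open>Values of characters and orthogonality\<close>

lemma (in group) hom_complex:
  assumes "\<eta> \<in> hom G complex_mult_group"
  shows "\<eta> \<one> = 1" "x \<in> carrier G \<Longrightarrow> \<eta> x \<noteq> 0"
    "\<lbrakk>x \<in> carrier G; y \<in> carrier G\<rbrakk> \<Longrightarrow> \<eta> (x \<otimes> y) = \<eta> x * \<eta> y"
proof -
  have "\<eta> (\<one> \<otimes> \<one>) = \<eta> \<one> * \<eta> \<one>"
    using assms one_closed unfolding hom_def by force
  moreover have "\<eta> \<one> \<noteq> 0"
    using assms by (auto simp: hom_def)
  ultimately show "\<eta> \<one> = 1" by simp
qed (use assms in \<open>auto simp: hom_def\<close>)

lemma (in group) hom_complex_pow_order: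
  assumes "\<eta> \<in> hom G complex_mult_group" "x \<in> carrier G"
  shows "\<eta> x ^ order G = 1"
proof -
  have "\<eta> (x [^] n) = \<eta> x ^ n" for n :: nat
    using assms by (induction n) (simp_all add: hom_complex[OF assms(1)])
  thus ?thesis using pow_order_eq_1[OF assms(2)] hom_complex[OF assms(1)] by metis
qed

lemma (in group) norm_hom_complex:
  assumes "finite (carrier G)" "\<eta> \<in> hom G complex_mult_group" "x \<in> carrier G"
  shows "norm (\<eta> x) = 1"
  using hom_complex_pow_order[OF assms(2,3)] assms(1) order_gt_0_iff_finite
  by (metis norm_one norm_power norm_ge_zero power_eq_1_iff power_eq_iff_eq_base zero_le_one power_one)

text \<open>Both sides are the inverse of \<open>\<eta> x\<close>, the conjugate because
  \<open>\<eta> x\<close> has norm 1.\<close>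

lemma (in group) cnj_hom_complex:
  assumes "finite (carrier G)" "\<eta> \<in> hom G complex_mult_group" "x \<in> carrier G"
  shows "cnj (\<eta> x) = \<eta> (inv x)"
proof -
  have "\<eta> (inv x) * \<eta> x = 1"
    using hom_complex[OF assms(2)] assms(3) by (metis inv_closed l_inv)
  moreover have "cnj (\<eta> x) * \<eta> x = 1"
    using norm_hom_complex[OF assms] by (metis complex_norm_square mult.commute of_real_1 power_one)
  ultimately show ?thesis
    using hom_complex(2)[OF assms(2,3)] by (metis mult_right_cancel)
qed

text \<open>An extensional character is determined by its values on the finite carrier, all of which
  are roots of unity of exponent \<open>order G\<close>.\<close>

lemma (in group) finite_characters:
  assumes "finite (carrier G)"
  shows "finite (characters G)"
proof (rule finite_subset)
  show "characters G \<subseteq> (\<Pi>\<^sub>E x\<in>carrier G. {z. z ^ order G = 1})"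
    unfolding characters_def by (intro subsetI PiE_I) (simp_all add: hom_complex_pow_order extensional_def)
  show "finite (\<Pi>\<^sub>E x\<in>carrier G. {z::complex. z ^ order G = 1})"
    using assms by (intro finite_PiE finite_roots_unity) (auto simp: order_gt_0_iff_finite Suc_le_eq)
qed

text \<open>Multiplication by a character \<open>\<psi>\<close> with
  \<open>\<psi> a \<noteq> 1\<close> permutes the characters, so the sum equals
  \<open>\<psi> a\<close> times itself.\<close>

lemma (in comm_group) sum_characters:
  assumes fin: "finite (carrier G)" and a: "a \<in> carrier G" "a \<noteq> \<one>"
  shows "(\<Sum>\<eta>\<in>characters G. \<eta> a) = 0"
proof -
  obtain \<psi> where psi: "\<psi> \<in> hom G complex_mult_group" "\<psi> a \<noteq> 1"
    using hom_separates[OF fin a] by blast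
  define T where "T = (\<lambda>\<eta>. restrict (\<lambda>x. \<psi> x * \<eta> x) (carrier G))"
  have "inj_on T (characters G)"
  proof (rule inj_onI)
    fix \<eta> \<eta>' assume *: "\<eta> \<in> characters G" "\<eta>' \<in> characters G" and eq: "T \<eta> = T \<eta>'"
    have "\<eta> x = \<eta>' x" if "x \<in> carrier G" for x
      using fun_cong[OF eq, of x] hom_complex(2)[OF psi(1) that] that by (simp add: T_def)
    thus "\<eta> = \<eta>'"
      using * by (intro extensionalityI[of _ "carrier G"]) (auto simp: characters_def)
  qed
  moreover have "T ` characters G \<subseteq> characters G"
    using hom_complex[OF psi(1)]
    by (auto simp: characters_def T_def hom_complex intro!: homI)
  \<comment> \<open>An injective self-map of a finite set is surjective.\<close>
  ultimately have "bij_betw T (characters G) (characters G)"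
    unfolding bij_betw_def using endo_inj_surj[OF finite_characters[OF fin]] by blast
  hence "(\<Sum>\<eta>\<in>characters G. \<eta> a) = (\<Sum>\<eta>\<in>characters G. T \<eta> a)"
    by (rule sum.reindex_bij_betw[symmetric])
  also have "\<dots> = \<psi> a * (\<Sum>\<eta>\<in>characters G. \<eta> a)"
    using a by (simp add: T_def sum_distrib_left)
  finally show ?thesis using psi(2) by simp
qed

text \<open>The dual argument: translation by \<open>y\<close> permutes the group and multiplies the
  sum by \<open>\<eta> y\<close>.\<close>

lemma (in comm_group) sum_hom_complex:
  assumes fin: "finite (carrier G)" and chi: "\<eta> \<in> hom G complex_mult_group"
    and y: "y \<in> carrier G" "\<eta> y \<noteq> 1"
  shows "(\<Sum>x\<in>carrier G. \<eta> x) = 0"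
proof -
  have "bij_betw (\<lambda>x. y \<otimes> x) (carrier G) (carrier G)"
    using y fin by (intro bij_betw_imageI inj_on_cmult surj_const_mult)
  hence "(\<Sum>x\<in>carrier G. \<eta> x) = (\<Sum>x\<in>carrier G. \<eta> (y \<otimes> x))"
    by (simp add: sum.reindex_bij_betw)
  also have "\<dots> = \<eta> y * (\<Sum>x\<in>carrier G. \<eta> x)"
    using y by (simp add: sum_distrib_left hom_complex[OF chi])
  finally show ?thesis using y(2) by simp
qed

text \<open>Double counting of \<open>\<Sum>\<^sub>\<eta> \<Sum>\<^sub>x \<eta> x\<close>.\<close>

lemma (in comm_group) card_characters:
  assumes fin: "finite (carrier G)"
  shows "card (characters G) = order G"
proof -
  define triv where "triv = restrict (\<lambda>_. 1 :: complex) (carrier G)"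
  have triv: "triv \<in> characters G"
    by (auto simp: triv_def characters_def hom_def)
  have "of_nat (order G) = (\<Sum>x\<in>carrier G. triv x)"
    by (simp add: triv_def order_def)
  also have "\<dots> = (\<Sum>\<eta>\<in>characters G. if \<eta> = triv then \<Sum>x\<in>carrier G. triv x else 0)"
    using triv finite_characters[OF fin] by simp
  also have "\<dots> = (\<Sum>\<eta>\<in>characters G. \<Sum>x\<in>carrier G. \<eta> x)"
  proof (rule sum.cong[OF refl])
    fix \<eta> assume chi: "\<eta> \<in> characters G"
    show "(if \<eta> = triv then \<Sum>x\<in>carrier G. triv x else 0) = (\<Sum>x\<in>carrier G. \<eta> x)"
    proof (cases "\<eta> = triv")
      case False
      then obtain y where "y \<in> carrier G" "\<eta> y \<noteq> 1"
        using chi extensionalityI[of \<eta> "carrier G" triv] by (auto simp: characters_def triv_def)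
      thus ?thesis using False chi sum_hom_complex[OF fin, of \<eta> y] by (simp add: characters_def)
    qed simp
  qed
  also have "\<dots> = (\<Sum>x\<in>carrier G. \<Sum>\<eta>\<in>characters G. \<eta> x)"
    by (rule sum.swap)
  also have "\<dots> = (\<Sum>x\<in>carrier G. if x = \<one> then of_nat (card (characters G)) else 0)"
    using sum_characters[OF fin] by (intro sum.cong) (auto simp: characters_def hom_complex(1))
  also have "\<dots> = of_nat (card (characters G))"
    using fin by simp
  finally show ?thesis by (metis of_nat_eq_iff)
qed

text \<open>Conjugation is inversion, so each summand is \<open>\<eta> (a \<otimes> inv g)\<close>.
  The sum vanishes unless this argument is \<open>\<one>\<close>, and then it counts the
  characters.\<close>

lemma (in comm_group) characters_orthogonal:
  assumes fin: "finite (carrier G)" and a: "a \<in> carrier G" and g: "g \<in> carrier G"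
  shows "(\<Sum>\<eta>\<in>characters G. \<eta> a * cnj (\<eta> g)) = (if a = g then of_nat (order G) else 0)"
proof -
  have "(\<Sum>\<eta>\<in>characters G. \<eta> a * cnj (\<eta> g)) = (\<Sum>\<eta>\<in>characters G. \<eta> (a \<otimes> inv g))"
    using a g fin by (intro sum.cong refl) (simp add: characters_def cnj_hom_complex hom_complex)
  moreover have "a \<otimes> inv g = \<one> \<longleftrightarrow> a = g"
    using a g by (metis inv_closed inv_equality inv_inv r_inv)
  moreover have "(\<Sum>\<eta>\<in>characters G. \<eta> \<one>) = of_nat (order G)"
    by (simp add: characters_def hom_complex flip: card_characters[OF fin])
  ultimately show ?thesis
    using sum_characters[OF fin, of "a \<otimes> inv g"] a g by auto
qed

section \<open>Cyclotomic polynomials by inclusion-exclusion\<close>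

text \<open>The monic polynomial of degree \<open>n\<close> with value \<open>z ^ n - 1\<close> is
  squarefree, hence the product of its linear factors over the roots of unity.\<close>

lemma prod_diff_exp_root_unity:
  fixes x :: complex
  assumes n: "n > 0"
  shows "(\<Prod>j\<in>{1..n}. x - exp (2 * of_real pi * \<i> * of_nat j / of_nat n)) = x ^ n - 1"
proof -
  define g where "g j = x - exp (2 * of_real pi * \<i> * of_nat j / of_nat n)" for j
  define p where "p = Polynomial.monom (1::complex) n - 1"
  have poly_p: "poly p z = z ^ n - 1" for z
    by (simp add: p_def poly_monom)
  \<comment> \<open>A multiple root would be a root of the derivative too, hence 0, which is not a
    root of \<open>p\<close>.\<close>
  have "rsquarefree p"
    unfolding rsquarefree_roots
    using n by (auto simp: poly_p) (auto simp: p_def pderiv_diff pderiv_monom poly_monom power_0_left)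
  moreover have "lead_coeff p = 1"
  proof -
    have "degree p = n"
      using n degree_add_eq_left[of "-1 :: complex poly" "Polynomial.monom 1 n"]
      by (simp add: p_def degree_monom_eq)
    thus ?thesis using n by (simp add: p_def)
  qed
  ultimately have "(\<Prod>z | z ^ n = 1. [:-z, 1:]) = p"
    using complex_poly_decompose_rsquarefree[of p] by (simp add: poly_p)
  hence "x ^ n - 1 = poly (\<Prod>z | z ^ n = 1. [:-z, 1:]) x"
    by (simp add: poly_p)
  also have "\<dots> = (\<Prod>z | z ^ n = 1. x - z)"
    by (simp add: poly_prod)
  also have "\<dots> = (\<Prod>k<n. x - cis (2 * pi * real k / real n))"
    by (rule prod.reindex_bij_betw[OF Complex.bij_betw_roots_unity[OF n], symmetric])
  also have "\<dots> = (\<Prod>k<n. g k)"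
    by (simp add: g_def cis_conv_exp mult_ac)
  \<comment> \<open>The indices 0 and \<open>n\<close> both give the root 1, so the range can be
    shifted to start at 1.\<close>
  also have "{..<n} = insert 0 {1..<n}"
    using n by auto
  also have "prod g (insert 0 {1..<n}) = prod g (insert n {1..<n})"
    using n by (simp add: g_def)
  also have "insert n {1..<n} = {1..n}"
    using n by auto
  finally show ?thesis by (simp add: g_def)
qed

text \<open>With \<open>j = d * i\<close> the fraction \<open>j / n\<close> becomes
  \<open>i / (n div d)\<close>, so exactly the roots of unity of exponent \<open>n div d\<close>
  remain.\<close>

lemma prod_diff_exp_root_unity_multiples:
  fixes x :: complex
  assumes n: "n > 0" and d: "d dvd n"
  shows "(\<Prod>j | j \<in> {1..n} \<and> d dvd j. x - exp (2 * of_real pi * \<i> * of_nat j / of_nat n))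
    = x ^ (n div d) - 1"
proof -
  obtain k where k: "n = d * k" using d by blast
  have pos: "d > 0" "k > 0" using n k by auto
  have "bij_betw (\<lambda>i. d * i) {1..k} {j. j \<in> {1..n} \<and> d dvd j}"
    using pos k by (intro bij_betwI[of _ _ _ "\<lambda>j. j div d"]) (auto elim!: dvdE)
  hence "(\<Prod>j | j \<in> {1..n} \<and> d dvd j. x - exp (2 * of_real pi * \<i> * of_nat j / of_nat n))
    = (\<Prod>i\<in>{1..k}. x - exp (2 * of_real pi * \<i> * of_nat (d * i) / of_nat n))"
    by (rule prod.reindex_bij_betw[symmetric])
  also have "\<dots> = (\<Prod>i\<in>{1..k}. x - exp (2 * of_real pi * \<i> * of_nat i / of_nat k))"
    using pos by (intro prod.cong refl) (simp add: k field_simps)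
  also have "\<dots> = x ^ k - 1"
    by (rule prod_diff_exp_root_unity[OF pos(2)])
  finally show ?thesis using pos k by simp
qed

section \<open>Coprimality as a signed sum over sets of primes\<close>

lemma prod_primes_dvd_iff:
  fixes S :: "nat set"
  assumes "finite S" "\<And>p. p \<in> S \<Longrightarrow> prime p"
  shows "\<Prod>S dvd j \<longleftrightarrow> (\<forall>p\<in>S. p dvd j)"
  using assms
proof (induction S rule: finite_induct)
  case (insert q S)
  have "coprime q (\<Prod>S)"
    using insert by (intro prod_coprime_right) (metis insertCI primes_coprime)
  thus ?case
    using insert by (auto simp: divides_mult)
qed auto

lemma prod_one_minus:
  fixes g :: "'a \<Rightarrow> 'b :: comm_ring_1"
  assumes "finite A"
  shows "(\<Prod>x\<in>A. 1 - g x) = (\<Sum>S\<in>Pow A. (-1) ^ card S * (\<Prod>x\<in>S. g x))"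
  using prod_diff_conv_sum[OF assms, of "\<lambda>_. 1" g] by simp

text \<open>Coprimality means that no prime factor of \<open>n\<close> divides \<open>j\<close>, so
  the indicator is a product of factors 1 minus a divisibility indicator; expanding it gives the
  sum. The values are integers because they will serve as exponents.\<close>

lemma coprime_indicator_eq_sum:
  fixes n j :: nat
  assumes "n > 0"
  shows "(if coprime j n then 1 else 0) =
    (\<Sum>S\<in>Pow (prime_factors n). (-1) ^ card S * (if \<Prod>S dvd j then 1 else 0 :: int))"
proof -
  have "coprime j n \<longleftrightarrow> (\<forall>p\<in>prime_factors n. \<not> p dvd j)"
  proof
    assume "coprime j n"
    thus "\<forall>p\<in>prime_factors n. \<not> p dvd j"
      by (metis coprime_common_divisor in_prime_factors_iff not_prime_unit)
  next
    assume *: "\<forall>p\<in>prime_factors n. \<not> p dvd j"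
    show "coprime j n"
    proof (rule ccontr)
      assume "\<not> coprime j n"
      then obtain p where "prime p" "p dvd gcd j n"
        using prime_factor_nat[of "gcd j n"] by (metis coprime_iff_gcd_eq_1)
      hence "p \<in> prime_factors n" "p dvd j"
        using assms by (simp_all add: in_prime_factors_iff)
      thus False using * by blast
    qed
  qed
  hence "(if coprime j n then 1 else 0) = (\<Prod>p\<in>prime_factors n. 1 - (if p dvd j then 1 else 0 :: int))"
    by auto
  also have "\<dots> = (\<Sum>S\<in>Pow (prime_factors n). (-1) ^ card S * (\<Prod>p\<in>S. if p dvd j then 1 else 0 :: int))"
    by (rule prod_one_minus) simp
  also have "\<dots> = (\<Sum>S\<in>Pow (prime_factors n). (-1) ^ card S * (if \<Prod>S dvd j then 1 else 0 :: int))"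
  proof (rule sum.cong[OF refl])
    fix S assume S: "S \<in> Pow (prime_factors n)"
    hence "finite S" using finite_subset by auto
    moreover have "\<Prod>S dvd j \<longleftrightarrow> (\<forall>p\<in>S. p dvd j)"
      using S \<open>finite S\<close> by (intro prod_primes_dvd_iff) auto
    ultimately show "(-1) ^ card S * (\<Prod>p\<in>S. if p dvd j then 1 else 0 :: int) =
        (-1) ^ card S * (if \<Prod>S dvd j then 1 else 0 :: int)"
      by auto
  qed
  finally show ?thesis .
qed

lemma power_int_sum_exponent:
  fixes x :: "'a :: field"
  assumes "x \<noteq> 0"
  shows "x powi (\<Sum>i\<in>A. c i) = (\<Prod>i\<in>A. x powi c i)"
  using assms by (induction A rule: infinite_finite_induct) (auto simp: power_int_add)

lemma prod_power_int_distrib: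
  fixes f :: "'b \<Rightarrow> 'a :: field"
  shows "(\<Prod>i\<in>A. f i powi c) = (\<Prod>i\<in>A. f i) powi c"
  by (induction A rule: infinite_finite_induct) (auto simp: power_int_mult_distrib)

lemma poly_cyclotomic_poly_eq_prod:
  fixes x :: complex
  assumes n: "n > 1" and x: "x ^ n \<noteq> 1"
  shows "poly (cyclotomic_poly n) x =
    (\<Prod>S\<in>Pow (prime_factors n). (1 - x ^ (n div \<Prod>S)) powi ((-1) ^ card S))"
proof -
  define f where "f j = x - exp (2 * of_real pi * \<i> * of_nat j / of_nat n)" for j :: nat
  let ?P = "prime_factors n"
  have n0: "n > 0" using n by simp
  \<comment> \<open>Nonvanishing is needed to turn a sum of exponents, some negative, into a product
    of powers.\<close>
  have nz: "f j \<noteq> 0" if "j \<in> {1..n}" for j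
  proof
    assume "f j = 0"
    hence "(\<Prod>j\<in>{1..n}. f j) = 0" using that by (intro prod_zero) auto
    thus False
      using prod_diff_exp_root_unity[OF n0, of x] x unfolding f_def by (metis eq_iff_diff_eq_0)
  qed
  have "poly (cyclotomic_poly n) x = (\<Prod>j | j \<in> {1..n} \<and> coprime j n. f j)"
    by (simp add: cyclotomic_poly_def poly_prod f_def conj_assoc)
  also have "\<dots> = (\<Prod>j\<in>{1..n}. if coprime j n then f j else 1)"
    by (simp add: prod.If_cases Int_def)
  \<comment> \<open>Moving the coprimality condition into the exponent lets the signed sum act
    multiplicatively.\<close>
  also have "\<dots> = (\<Prod>j\<in>{1..n}. f j powi (if coprime j n then 1 else 0))"
    by (intro prod.cong) auto
  also have "\<dots> = (\<Prod>j\<in>{1..n}. \<Prod>S\<in>Pow ?P. f j powi ((-1) ^ card S * (if \<Prod>S dvd j then 1 else 0)))"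
    by (intro prod.cong refl) (simp only: coprime_indicator_eq_sum[OF n0] power_int_sum_exponent[OF nz])
  also have "\<dots> = (\<Prod>S\<in>Pow ?P. \<Prod>j\<in>{1..n}. f j powi ((-1) ^ card S * (if \<Prod>S dvd j then 1 else 0)))"
    by (rule prod.swap)
  also have "\<dots> = (\<Prod>S\<in>Pow ?P. - ((1 - x ^ (n div \<Prod>S)) powi ((-1) ^ card S)))"
  proof (rule prod.cong[OF refl])
    fix S assume S: "S \<in> Pow ?P"
    hence fin: "finite S" using finite_subset by auto
    have dvd: "\<Prod>S dvd n"
      using S fin by (subst prod_primes_dvd_iff) auto
    have "(\<Prod>j\<in>{1..n}. f j powi ((-1) ^ card S * (if \<Prod>S dvd j then 1 else 0)))
      = (\<Prod>j\<in>{1..n}. if \<Prod>S dvd j then f j powi ((-1) ^ card S) else 1)"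
      by (intro prod.cong) auto
    also have "\<dots> = (\<Prod>j | j \<in> {1..n} \<and> \<Prod>S dvd j. f j powi ((-1) ^ card S))"
      by (simp add: prod.If_cases Int_def)
    also have "\<dots> = (x ^ (n div \<Prod>S) - 1) powi ((-1) ^ card S)"
      unfolding prod_power_int_distrib f_def prod_diff_exp_root_unity_multiples[OF n0 dvd] ..
    \<comment> \<open>The exponent is 1 or -1, hence odd, so reversing the difference costs one sign
      for each \<open>S\<close>.\<close>
    also have "\<dots> = - ((1 - x ^ (n div \<Prod>S)) powi ((-1) ^ card S))"
      by (cases "even (card S)") (auto simp: divide_simps)
    finally show "(\<Prod>j\<in>{1..n}. f j powi ((-1) ^ card S * (if \<Prod>S dvd j then 1 else 0)))
      = - ((1 - x ^ (n div \<Prod>S)) powi ((-1) ^ card S))" .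
  qed
  also have "\<dots> = (-1) ^ card (Pow ?P) * (\<Prod>S\<in>Pow ?P. (1 - x ^ (n div \<Prod>S)) powi ((-1) ^ card S))"
    by (rule prod_uminus)
  \<comment> \<open>A number above 1 has a prime factor, so the number of subsets is a positive
    power of 2.\<close>
  also have "(-1) ^ card (Pow ?P) = (1 :: complex)"
  proof -
    have "?P \<noteq> {}" using n by (simp add: prime_factorization_empty_iff)
    thus ?thesis by (simp add: card_Pow card_gt_0_iff)
  qed
  finally show ?thesis by simp
qed

section \<open>Dirichlet characters\<close>

lemma
  assumes "m > 1"
  shows comm_group_mult_group_mod: "comm_group (mult_group_mod m)"
    and carrier_mult_group_mod:
      "carrier (mult_group_mod m) = {x. 0 < x \<and> x < int m \<and> coprime x (int m)}"
    and finite_mult_group_mod: "finite (carrier (mult_group_mod m))"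
    and order_mult_group_mod: "Coset.order (mult_group_mod m) = totient m"
    and mult_mult_group_mod: "x \<otimes>\<^bsub>mult_group_mod m\<^esub> y = x * y mod int m"
    and mod_in_mult_group_mod: "coprime a (int m) \<Longrightarrow> a mod int m \<in> carrier (mult_group_mod m)"
proof -
  interpret residues "int m" "residue_ring (int m)"
    by unfold_locales (use assms in simp_all)
  show "comm_group (mult_group_mod m)"
    by (simp add: mult_group_mod_def units_comm_group)
  show carrier: "carrier (mult_group_mod m) = {x. 0 < x \<and> x < int m \<and> coprime x (int m)}"
    by (simp add: mult_group_mod_def units_of_carrier res_units_eq)
  show "finite (carrier (mult_group_mod m))"
    by (rule finite_subset[of _ "{0..int m}"]) (auto simp: carrier)
  show "Coset.order (mult_group_mod m) = totient m"
    using totient_eq by (simp add: mult_group_mod_def Coset.order_def units_of_carrier)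
  show "x \<otimes>\<^bsub>mult_group_mod m\<^esub> y = x * y mod int m"
    by (simp add: mult_group_mod_def units_of_mult res_mult_eq)
  show "a mod int m \<in> carrier (mult_group_mod m)" if "coprime a (int m)"
    using that mod_in_res_units assms by (simp add: mult_group_mod_def units_of_carrier)
qed

text \<open>\<open>extend_character\<close> reads a homomorphism only at residues in the carrier.
  Restriction to the carrier therefore loses nothing, and distinct extensional characters stay
  distinct. Sums over Dirichlet characters thereby become sums over group characters.\<close>

lemma bij_betw_extend_character:
  assumes m: "m > 1"
  shows "bij_betw (extend_character m) (characters (mult_group_mod m)) (dirichlet_characters m)"
proof (rule bij_betw_imageI)
  let ?G = "mult_group_mod m"
  show "inj_on (extend_character m) (characters ?G)"
  proof (rule inj_onI)
    fix h h' assume *: "h \<in> characters ?G" "h' \<in> characters ?G"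
      and eq: "extend_character m h = extend_character m h'"
    have "h x = h' x" if "x \<in> carrier ?G" for x
      using fun_cong[OF eq, of x] that by (simp add: extend_character_def carrier_mult_group_mod[OF m])
    thus "h = h'"
      using * by (intro extensionalityI[of _ "carrier ?G"]) (auto simp: characters_def)
  qed
  show "extend_character m ` characters ?G = dirichlet_characters m"
    unfolding dirichlet_characters_def
  proof (intro equalityI subsetI)
    fix \<eta> assume "\<eta> \<in> extend_character m ` hom ?G complex_mult_group"
    then obtain h where h: "h \<in> hom ?G complex_mult_group" "\<eta> = extend_character m h"
      by blast
    interpret comm_group ?G by (rule comm_group_mult_group_mod[OF m])
    have "restrict h (carrier ?G) \<in> characters ?G"
      using h(1) by (auto simp: characters_def hom_def)
    moreover have "\<eta> = extend_character m (restrict h (carrier ?G))"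
      using mod_in_mult_group_mod[OF m] by (auto simp: h(2) extend_character_def)
    ultimately show "\<eta> \<in> extend_character m ` characters ?G"
      by blast
  qed (auto simp: characters_def)
qed

lemma dirichlet_characters_orthogonal:
  assumes m: "m > 1" and a: "coprime a (int m)" and g: "coprime g (int m)"
  shows "(\<Sum>\<eta>\<in>dirichlet_characters m. \<eta> a * cnj (\<eta> g)) =
    (if a mod int m = g mod int m then of_nat (totient m) else 0)"
proof -
  let ?G = "mult_group_mod m"
  interpret comm_group ?G by (rule comm_group_mult_group_mod[OF m])
  have "(\<Sum>\<eta>\<in>dirichlet_characters m. \<eta> a * cnj (\<eta> g)) =
      (\<Sum>h\<in>characters ?G. extend_character m h a * cnj (extend_character m h g))"
    by (rule sum.reindex_bij_betw[OF bij_betw_extend_character[OF m], symmetric])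
  also have "\<dots> = (\<Sum>h\<in>characters ?G. h (a mod int m) * cnj (h (g mod int m)))"
    using a g by (simp add: extend_character_def)
  also have "\<dots> = (if a mod int m = g mod int m then of_nat (totient m) else 0)"
    using characters_orthogonal[OF finite_mult_group_mod[OF m]] mod_in_mult_group_mod[OF m] a g
    by (simp add: order_mult_group_mod[OF m])
  finally show ?thesis .
qed

lemma dirichlet_character_mult:
  assumes m: "m > 1" and "\<eta> \<in> dirichlet_characters m"
  shows "\<eta> (a * b) = \<eta> a * \<eta> b"
proof -
  obtain h where h: "h \<in> hom (mult_group_mod m) complex_mult_group" "\<eta> = extend_character m h"
    using assms(2) by (auto simp: dirichlet_characters_def)
  have "h (a mod int m * (b mod int m) mod int m) = h (a mod int m) * h (b mod int m)"
    if "coprime a (int m)" "coprime b (int m)"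
    using hom_mult[OF h(1) mod_in_mult_group_mod[OF m that(1)] mod_in_mult_group_mod[OF m that(2)]]
    by (simp add: mult_mult_group_mod[OF m])
  \<comment> \<open>If \<open>a\<close> or \<open>b\<close> shares a factor with \<open>m\<close>,
    so does the product, and both sides are 0.\<close>
  thus ?thesis
    by (auto simp: h(2) extend_character_def mod_mult_eq)
qed

lemma norm_dirichlet_character:
  assumes m: "m > 1" and "\<eta> \<in> dirichlet_characters m" and a: "coprime a (int m)"
  shows "norm (\<eta> a) = 1"
proof -
  interpret comm_group "mult_group_mod m" by (rule comm_group_mult_group_mod[OF m])
  show ?thesis
    using assms(2) a norm_hom_complex[OF finite_mult_group_mod[OF m]] mod_in_mult_group_mod[OF m a]
    by (auto simp: dirichlet_characters_def extend_character_def)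
qed

lemma dirichlet_character_prod:
  assumes m: "m > 1" and eta: "\<eta> \<in> dirichlet_characters m"
  shows "\<eta> (int (\<Prod>S)) = (\<Prod>p\<in>S. \<eta> (int p))"
proof (induction S rule: infinite_finite_induct)
  case (insert p S)
  thus ?case by (simp add: dirichlet_character_mult[OF m eta])
next
  \<comment> \<open>\<open>\<eta> 1\<close> equals its own square and is nonzero, having norm
    1.\<close>
  have "\<eta> 1 = 1"
    using dirichlet_character_mult[OF m eta, of 1 1] norm_dirichlet_character[OF m eta, of 1] by auto
  {
    case (infinite S)
    thus ?case using \<open>\<eta> 1 = 1\<close> by simp
  next
    case empty
    show ?case using \<open>\<eta> 1 = 1\<close> by simp
  }
qed

text \<open>Expand the product over the primes. As \<open>\<Prod>S\<close> divides \<open>n\<close>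
  it is coprime to \<open>m\<close>, so \<open>\<eta>\<close> has norm 1 there and multiplying by
  its conjugate divides the argument by \<open>\<Prod>S\<close>.\<close>

lemma dirichlet_character_euler_factors:
  assumes m: "m > 1" and n: "n > 0" "coprime n m" and eta: "\<eta> \<in> dirichlet_characters m"
  shows "\<eta> (int n) * (\<Prod>p\<in>prime_factors n. 1 - cnj (\<eta> (int p))) =
    (\<Sum>S\<in>Pow (prime_factors n). (-1) ^ card S * \<eta> (int (n div \<Prod>S)))"
proof -
  have *: "\<eta> (int n) * (\<Prod>p\<in>S. cnj (\<eta> (int p))) = \<eta> (int (n div \<Prod>S))"
    if S: "S \<in> Pow (prime_factors n)" for S
  proof -
    have fin: "finite S" using S finite_subset by auto
    have dvd: "\<Prod>S dvd n"
      using S fin by (subst prod_primes_dvd_iff) auto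
    have "coprime (int (\<Prod>S)) (int m)"
      using dvd n(2) by (metis coprime_divisors coprime_int_iff dvd_refl)
    hence "\<eta> (int (\<Prod>S)) * cnj (\<eta> (int (\<Prod>S))) = 1"
      using norm_dirichlet_character[OF m eta] by (metis complex_norm_square of_real_1 power_one)
    moreover have "\<eta> (int n) = \<eta> (int (n div \<Prod>S)) * \<eta> (int (\<Prod>S))"
      using dvd by (metis dirichlet_character_mult[OF m eta] dvd_div_mult_self of_nat_mult)
    moreover have "(\<Prod>p\<in>S. cnj (\<eta> (int p))) = cnj (\<eta> (int (\<Prod>S)))"
      by (simp add: dirichlet_character_prod[OF m eta] del: of_nat_prod)
    ultimately show ?thesis
      by (metis mult.assoc mult.right_neutral)
  qed
  have "\<eta> (int n) * (\<Prod>p\<in>prime_factors n. 1 - cnj (\<eta> (int p))) =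
      (\<Sum>S\<in>Pow (prime_factors n). (-1) ^ card S * (\<eta> (int n) * (\<Prod>p\<in>S. cnj (\<eta> (int p)))))"
    by (simp add: prod_one_minus sum_distrib_left mult.left_commute)
  also have "\<dots> = (\<Sum>S\<in>Pow (prime_factors n). (-1) ^ card S * \<eta> (int (n div \<Prod>S)))"
    by (intro sum.cong refl) (simp only: *)
  finally show ?thesis .
qed

text \<open>After both factors are expanded and the sum over characters is moved innermost,
  orthogonality keeps, for each \<open>S\<close>, only the \<open>g\<close> congruent to
  \<open>n div \<Prod>S\<close> modulo \<open>m\<close>.\<close>

lemma sum_C_chi:
  assumes m: "m > 1" and n: "n > 0" "coprime n m" and xi: "\<xi> ^ m = 1"
  shows "(\<Sum>\<eta>\<in>dirichlet_characters m.
      C_chi m \<eta> \<xi> * \<eta> (int n) * (\<Prod>p\<in>prime_factors n. 1 - cnj (\<eta> (int p)))) =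
    of_nat (totient m) * (\<Sum>S\<in>Pow (prime_factors n). (-1) ^ card S * Ln (1 - \<xi> ^ (n div \<Prod>S)))"
proof -
  let ?D = "dirichlet_characters m" and ?P = "Pow (prime_factors n)"
  let ?U = "carrier (mult_group_mod m)"
  have inner: "(\<Sum>g\<in>?U. Ln (1 - \<xi> powi g) * (\<Sum>\<eta>\<in>?D. \<eta> (int k) * cnj (\<eta> g))) =
      of_nat (totient m) * Ln (1 - \<xi> ^ k)" if k: "coprime k m" for k
  proof -
    have k': "coprime (int k) (int m)" using k by simp
    \<comment> \<open>The surviving \<open>g\<close> is only the residue of \<open>k\<close>; as
      \<open>\<xi> ^ m = 1\<close>, reducing the exponent does not change the power.\<close>
    have "\<xi> ^ k = \<xi> ^ (m * (k div m) + k mod m)" by simp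
    also have "\<dots> = \<xi> ^ (k mod m)"
      using xi by (simp only: power_add power_mult power_one mult_1)
    finally have xi_mod: "\<xi> powi (int k mod int m) = \<xi> ^ k"
      by (simp flip: of_nat_mod)
    have "(\<Sum>g\<in>?U. Ln (1 - \<xi> powi g) * (\<Sum>\<eta>\<in>?D. \<eta> (int k) * cnj (\<eta> g))) =
        (\<Sum>g\<in>?U. if g = int k mod int m then of_nat (totient m) * Ln (1 - \<xi> powi g) else 0)"
      using dirichlet_characters_orthogonal[OF m k']
      by (intro sum.cong refl) (auto simp: carrier_mult_group_mod[OF m])
    also have "\<dots> = of_nat (totient m) * Ln (1 - \<xi> ^ k)"
      using finite_mult_group_mod[OF m] mod_in_mult_group_mod[OF m k'] by (simp add: xi_mod)
    finally show ?thesis .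
  qed
  have "(\<Sum>\<eta>\<in>?D. C_chi m \<eta> \<xi> * \<eta> (int n) * (\<Prod>p\<in>prime_factors n. 1 - cnj (\<eta> (int p)))) =
      (\<Sum>\<eta>\<in>?D. \<Sum>S\<in>?P. \<Sum>g\<in>?U.
        (-1) ^ card S * (Ln (1 - \<xi> powi g) * (\<eta> (int (n div \<Prod>S)) * cnj (\<eta> g))))"
    by (intro sum.cong refl)
       (simp only: mult.assoc dirichlet_character_euler_factors[OF m n] C_chi_def sum_product,
        subst sum.swap, simp only: mult_ac)
  also have "\<dots> = (\<Sum>S\<in>?P. \<Sum>\<eta>\<in>?D. \<Sum>g\<in>?U.
        (-1) ^ card S * (Ln (1 - \<xi> powi g) * (\<eta> (int (n div \<Prod>S)) * cnj (\<eta> g))))"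
    by (rule sum.swap)
  also have "\<dots> = (\<Sum>S\<in>?P. \<Sum>g\<in>?U. \<Sum>\<eta>\<in>?D.
        (-1) ^ card S * (Ln (1 - \<xi> powi g) * (\<eta> (int (n div \<Prod>S)) * cnj (\<eta> g))))"
    by (intro sum.cong refl sum.swap)
  also have "\<dots> = (\<Sum>S\<in>?P. (-1) ^ card S *
        (\<Sum>g\<in>?U. Ln (1 - \<xi> powi g) * (\<Sum>\<eta>\<in>?D. \<eta> (int (n div \<Prod>S)) * cnj (\<eta> g))))"
    by (simp only: sum_distrib_left)
  also have "\<dots> = (\<Sum>S\<in>?P. (-1) ^ card S * (of_nat (totient m) * Ln (1 - \<xi> ^ (n div \<Prod>S))))"
  proof (intro sum.cong refl)
    fix S assume S: "S \<in> ?P"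
    hence "finite S" using finite_subset by auto
    hence "\<Prod>S dvd n" using S by (subst prod_primes_dvd_iff) auto
    hence "coprime (n div \<Prod>S) m"
      using n(2) by (metis coprime_divisors div_dvd_iff_mult dvd_div_mult_self dvd_refl dvd_triv_left)
    from inner[OF this]
    show "(-1) ^ card S * (\<Sum>g\<in>?U. Ln (1 - \<xi> powi g) * (\<Sum>\<eta>\<in>?D. \<eta> (int (n div \<Prod>S)) * cnj (\<eta> g))) =
        (-1) ^ card S * (of_nat (totient m) * Ln (1 - \<xi> ^ (n div \<Prod>S)))"
      by simp
  qed
  also have "\<dots> = of_nat (totient m) * (\<Sum>S\<in>?P. (-1) ^ card S * Ln (1 - \<xi> ^ (n div \<Prod>S)))"
    by (simp add: sum_distrib_left mult.left_commute)
  finally show ?thesis .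
qed

section \<open>Evaluation at a primitive root of unity\<close>

lemma primitive_root_of_unity_power_eq_1:
  assumes "primitive_root_of_unity m \<xi>" "m > 1" "coprime k m"
  shows "\<xi> ^ k \<noteq> 1"
proof
  assume k: "\<xi> ^ k = 1"
  have xi: "\<xi> ^ m = 1" "\<And>d. 1 \<le> d \<Longrightarrow> d < m \<Longrightarrow> \<xi> ^ d \<noteq> 1"
    using assms(1) by (auto simp: primitive_root_of_unity_def)
  have "k \<noteq> 0" using assms(2,3) by (auto intro: ccontr)
  \<comment> \<open>With this Bezout relation, \<open>\<xi> ^ k = 1\<close> and
    \<open>\<xi> ^ m = 1\<close> give \<open>\<xi> = 1\<close>, against primitivity at exponent
    1.\<close>
  then obtain a b where "k * a = m * b + 1"
    using bezout_nat[of k m] assms(3) by auto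
  hence "\<xi> ^ (k * a) = \<xi> ^ (m * b + 1)" by simp
  hence "\<xi> ^ 1 = 1" using k xi(1) by (simp add: power_add power_mult)
  thus False using xi(2)[of 1] assms(2) by simp
qed

theorem theorem1:
  fixes n m :: nat and \<xi> :: complex
  assumes "n > 1" and "m > 1" and "coprime n m"
    and "primitive_root_of_unity m \<xi>"
  shows "poly (cyclotomic_poly n) \<xi> =
    exp (1 / of_nat (totient m) *
      (\<Sum>chi\<in>dirichlet_characters m.
         C_chi m chi \<xi> * chi (int n) * (\<Prod>p\<in>prime_factors n. 1 - cnj (chi (int p)))))"
proof -
  let ?P = "Pow (prime_factors n)"
  have xi: "\<xi> ^ m = 1"
    using assms(4) by (simp add: primitive_root_of_unity_def)
  have nontriv: "\<xi> ^ n \<noteq> 1"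
    using primitive_root_of_unity_power_eq_1 assms by blast
  have "poly (cyclotomic_poly n) \<xi> = (\<Prod>S\<in>?P. (1 - \<xi> ^ (n div \<Prod>S)) powi ((-1) ^ card S))"
    by (rule poly_cyclotomic_poly_eq_prod[OF assms(1) nontriv])
  also have "\<dots> = (\<Prod>S\<in>?P. exp ((-1) ^ card S * Ln (1 - \<xi> ^ (n div \<Prod>S))))"
  proof (intro prod.cong refl)
    fix S assume S: "S \<in> ?P"
    hence "finite S" using finite_subset by auto
    hence "\<Prod>S dvd n" using S by (subst prod_primes_dvd_iff) auto
    \<comment> \<open>Otherwise raising to the power \<open>\<Prod>S\<close> would give
      \<open>\<xi> ^ n = 1\<close>. Hence \<open>Ln\<close> is taken at a nonzero number, where
      \<open>exp\<close> inverts it.\<close>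
    hence "\<xi> ^ (n div \<Prod>S) \<noteq> 1"
      using nontriv by (metis dvd_div_mult_self power_mult power_one)
    hence "(1 - \<xi> ^ (n div \<Prod>S)) powi ((-1) ^ card S) =
        exp (Ln (1 - \<xi> ^ (n div \<Prod>S))) powi ((-1) ^ card S)"
      by simp
    thus "(1 - \<xi> ^ (n div \<Prod>S)) powi ((-1) ^ card S) =
        exp ((-1) ^ card S * Ln (1 - \<xi> ^ (n div \<Prod>S)))"
      by (simp add: exp_power_int)
  qed
  also have "\<dots> = exp (\<Sum>S\<in>?P. (-1) ^ card S * Ln (1 - \<xi> ^ (n div \<Prod>S)))"
    by (simp add: exp_sum)
  \<comment> \<open>The factor \<open>totient m\<close>, nonzero for \<open>m > 1\<close>, is
    inserted to match the right-hand side of \<open>sum_C_chi\<close>.\<close>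
  also have "(\<Sum>S\<in>?P. (-1) ^ card S * Ln (1 - \<xi> ^ (n div \<Prod>S))) =
      1 / of_nat (totient m) * (of_nat (totient m) *
        (\<Sum>S\<in>?P. (-1) ^ card S * Ln (1 - \<xi> ^ (n div \<Prod>S))))"
    using assms(2) by simp
  also note sum_C_chi[OF assms(2) _ assms(3) xi, symmetric]
  finally show ?thesis using assms(1) by simp
qed

end
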